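(* Let $U\subset\mathbb{C}$ be an open disk-shaped neighborhood of the origin, let $z\in U$, and let $f:\mathbb{C}\to\mathbb{C}$ be analytic and nonzero in $U$ with $f(0)=1$. Let $r\in\mathbb{C}$ satisfy $|r|>1$ and $\Re(r^k)\ge 1/2$ for every integer $k\ge1$, and take $r_k=r$ for all $k\geq 1$. Then for every nonempty finite set $S\subset\mathbb{N}$ the geometric sampling product $P(f,S,z)$ satisfies $$P(f,S,z)=\prod_{n=|S|}^{\infty}\left[f\left(\left[\prod_{k\in S}(r^k-1)^{1/k}\right]\frac{z}{r^n}\right)\right]^{\binom{n-1}{|S|-1}}.$$
   Context: $\mathbb{N}=\{1,2,3,\dots\}$. For complex numbers $r_k$ with $1<|r_k|<\infty$ ($k\ge 1$), set $X_{k,n}=[(r_k)^k-1]^{1/k}\cdot (r_k)^{-n}$ for $n\ge 1$. The geometric sampling product is $$P(f,S,z)=\prod_{\substack{(n_k)_{k\in S}\\ n_k\ge1\ \forall k\in S}} f\left(\left[\prod_{k\in S}X_{k,n_k}\right]z\right),$$ the product over all tuples of positive integers indexed by $S$. The root is the $k$-th root $[(r_k)^k-1]^{1/k}=r_k(1-(r_k)^{-k})^{1/k}$ with the principal $k$-th root of $1-(r_k)^{-k}$ (which has positive real part). *)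

theory Defs
  imports "HOL-Analysis.Analysis"
begin

(* Products over an arbitrary index set with no prescribed order: the multiplicative analogue of
   HAS_SUM, with the usual convention for infinite products (as in has_prod) that only finitely
   many factors vanish and that the product of the remaining ones has a nonzero limit. *)
definition has_prod_on :: "('i \<Rightarrow> complex) \<Rightarrow> 'i set \<Rightarrow> complex \<Rightarrow> bool" where
  "has_prod_on g A p \<longleftrightarrow>
     finite {i\<in>A. g i = 0} \<and>
     (\<exists>q. q \<noteq> 0 \<and>
          (prod g \<longlongrightarrow> q) (finite_subsets_at_top {i\<in>A. g i \<noteq> 0}) \<and>
          p = q * prod g {i\<in>A. g i = 0})"

definition convergent_prod_on :: "('i \<Rightarrow> complex) \<Rightarrow> 'i set \<Rightarrow> bool" where
  "convergent_prod_on g A \<longleftrightarrow> (\<exists>p. has_prod_on g A p)"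

definition prod_on :: "('i \<Rightarrow> complex) \<Rightarrow> 'i set \<Rightarrow> complex" where
  "prod_on g A = (THE p. has_prod_on g A p)"

(* The k-th root (r^k - 1)^(1/k), on the branch r * (1 - r^(-k))^(1/k); powr is the principal
   power, and 1 - r^(-k) has positive real part when |r| > 1 and k \<ge> 1. *)
definition sampling_root :: "complex \<Rightarrow> nat \<Rightarrow> complex" where
  "sampling_root r k = r * (1 - 1 / r ^ k) powr (1 / of_nat k)"

definition sampling_X :: "(nat \<Rightarrow> complex) \<Rightarrow> nat \<Rightarrow> nat \<Rightarrow> complex" where
  "sampling_X r k n = sampling_root (r k) k / r k ^ n"

definition sampling_tuples :: "nat set \<Rightarrow> (nat \<Rightarrow> nat) set" where
  "sampling_tuples S = (\<Pi>\<^sub>E k\<in>S. {1..})"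

definition sampling_factor ::
  "(nat \<Rightarrow> complex) \<Rightarrow> (complex \<Rightarrow> complex) \<Rightarrow> nat set \<Rightarrow> complex \<Rightarrow> (nat \<Rightarrow> nat) \<Rightarrow> complex" where
  "sampling_factor r f S z n = f ((\<Prod>k\<in>S. sampling_X r k (n k)) * z)"

definition geometric_sampling_product ::
  "(nat \<Rightarrow> complex) \<Rightarrow> (complex \<Rightarrow> complex) \<Rightarrow> nat set \<Rightarrow> complex \<Rightarrow> complex" where
  "geometric_sampling_product r f S z = prod_on (sampling_factor r f S z) (sampling_tuples S)"

end

(* Write a tuple factor as g (\<Sum>n_k), where g N = f (C z / r^N) and C is the product of the roots.
   Since g N - 1 = O(r^(-N)) and the tuple sum of |r|^(-\<Sum>n_k) is a product of geometric series,
   the product over tuples converges absolutely, up to finitely many vanishing factors: f is not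
   controlled at the finitely many arguments that may leave U.  Grouping the tuples by \<Sum>n_k = N
   gives the claim, since there are (N - 1 choose |S| - 1) compositions of N into |S| parts. *)
theory Submission
  imports Defs
begin

section \<open>Unordered products\<close>

lemma has_prod_on_cong:
  assumes "\<And>i. i \<in> A \<Longrightarrow> g i = h i"
  shows "has_prod_on g A p \<longleftrightarrow> has_prod_on h A p"
proof -
  have sets: "{i\<in>A. g i = 0} = {i\<in>A. h i = 0}" "{i\<in>A. g i \<noteq> 0} = {i\<in>A. h i \<noteq> 0}"
    using assms by auto
  have "prod g F = prod h F" if "F \<subseteq> A" for F
    using that assms by (intro prod.cong) auto
  then have "(prod g \<longlongrightarrow> q) (finite_subsets_at_top {i\<in>A. h i \<noteq> 0}) \<longleftrightarrow>
      (prod h \<longlongrightarrow> q) (finite_subsets_at_top {i\<in>A. h i \<noteq> 0})"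
    and "prod g {i\<in>A. h i = 0} = prod h {i\<in>A. h i = 0}" for q
    by (auto intro!: tendsto_cong eventually_finite_subsets_at_top_weakI)
  then show ?thesis
    unfolding has_prod_on_def sets by simp
qed

lemma has_prod_on_unique:
  assumes "has_prod_on g A p" "has_prod_on g A p'"
  shows "p = p'"
  using assms unfolding has_prod_on_def
  by (metis finite_subsets_at_top_neq_bot tendsto_unique)

lemma prod_on_eqI:
  assumes "has_prod_on g A p"
  shows "prod_on g A = p"
  unfolding prod_on_def using assms has_prod_on_unique by (intro the_equality) auto

section \<open>Absolute convergence of unordered products\<close>

lemma finite_ge_of_summable_on:
  fixes h :: "'i \<Rightarrow> real"
  assumes "h summable_on A" and nonneg: "\<And>i. i \<in> A \<Longrightarrow> h i \<ge> 0" and "e > 0"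
  shows "finite {i\<in>A. h i \<ge> e}"
proof (rule ccontr)
  assume "infinite {i\<in>A. h i \<ge> e}"
  \<comment> \<open>Infinitely many values of size at least \<open>e\<close> would give finite
    subsums \<open>n * e\<close> for every \<open>n\<close>, so \<open>n\<close> is chosen to push
    such a subsum past the total.\<close>
  obtain n :: nat where n: "infsum h A < real n * e"
    using reals_Archimedean3[OF \<open>e > 0\<close>] by blast
  obtain F where F: "finite F" "card F = n" "F \<subseteq> {i\<in>A. h i \<ge> e}"
    using infinite_arbitrarily_large[OF \<open>infinite {i\<in>A. h i \<ge> e}\<close>] by blast
  have "real n * e \<le> sum h F"
    using F sum_mono[of F "\<lambda>_. e" h] by auto
  also have "\<dots> \<le> infsum h A"
    using F nonneg assms(1) by (intro finite_sum_le_infsum) auto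
  finally show False
    using n by simp
qed

text \<open>Pass to logarithms: near 1 one has |Ln (1 + w)| \<le> 2 |w|, so the logarithms of the
  nonzero factors are summable, and exponentiating their sum gives the limit. That limit is an
  exponential, hence nonzero, as \<open>has_prod_on\<close> demands.\<close>

lemma convergent_prod_on_of_abs_summable:
  assumes "(\<lambda>i. norm (g i - 1)) summable_on A"
  shows "convergent_prod_on g A"
proof -
  define B where "B = {i\<in>A. g i \<noteq> 0}"
  have fin: "finite {i\<in>A. norm (g i - 1) \<ge> 1/2}"
    using assms by (intro finite_ge_of_summable_on) auto
  have finZ: "finite {i\<in>A. g i = 0}"
    by (rule finite_subset[OF _ fin]) auto
  \<comment> \<open>The logarithm bound needs factors within 1/2 of 1. The other nonzero factors,
    \<open>B - C\<close>, are finite in number; for them only exp (Ln w) = w matters.\<close>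
  define C where "C = {i\<in>B. norm (g i - 1) < 1/2}"
  have "(\<lambda>i. 2 * norm (g i - 1)) summable_on C"
    using assms by (intro summable_on_cmult_right summable_on_subset_banach[OF assms])
      (auto simp: B_def C_def)
  then have "(\<lambda>i. norm (Ln (g i))) summable_on C"
  proof (rule Infinite_Sum.abs_summable_on_comparison_test')
    fix i assume "i \<in> C"
    then show "norm (Ln (g i)) \<le> 2 * norm (g i - 1)"
      using norm_Ln_le[of "g i - 1"] by (simp add: C_def)
  qed
  then have "(\<lambda>i. Ln (g i)) summable_on C"
    by (rule abs_summable_summable)
  moreover have "(\<lambda>i. Ln (g i)) summable_on (B - C)"
    by (rule summable_on_finite, rule finite_subset[OF _ fin]) (auto simp: B_def C_def)
  ultimately have "(\<lambda>i. Ln (g i)) summable_on C \<union> (B - C)"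
    by (rule summable_on_union)
  moreover have "C \<union> (B - C) = B"
    by (auto simp: C_def)
  ultimately obtain T where "((\<lambda>i. Ln (g i)) has_sum T) B"
    by (auto simp: summable_on_def)
  then have "((\<lambda>F. exp (\<Sum>i\<in>F. Ln (g i))) \<longlongrightarrow> exp T) (finite_subsets_at_top B)"
    unfolding has_sum_def by (intro tendsto_exp)
  moreover have "eventually (\<lambda>F. exp (\<Sum>i\<in>F. Ln (g i)) = prod g F) (finite_subsets_at_top B)"
  proof (rule eventually_finite_subsets_at_top_weakI)
    fix F assume "finite F" "F \<subseteq> B"
    then show "exp (\<Sum>i\<in>F. Ln (g i)) = prod g F"
      by (auto simp: exp_sum B_def intro!: prod.cong)
  qed
  ultimately have "(prod g \<longlongrightarrow> exp T) (finite_subsets_at_top B)"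
    by (rule Lim_transform_eventually)
  then have "has_prod_on g A (exp T * prod g {i\<in>A. g i = 0})"
    unfolding has_prod_on_def B_def[symmetric] using finZ exp_not_eq_zero by blast
  then show ?thesis
    by (auto simp: convergent_prod_on_def)
qed

section \<open>Regrouping along fibres and passage to sequential products\<close>

lemma prod_group_fibres:
  assumes "finite F" and "\<And>j. j \<in> F \<Longrightarrow> finite {i\<in>A. \<phi> i = j}"
  shows "prod (\<lambda>i. g (\<phi> i)) {i\<in>A. \<phi> i \<in> F} = (\<Prod>j\<in>F. g j ^ card {i\<in>A. \<phi> i = j})"
proof -
  have fin: "finite {i\<in>A. \<phi> i \<in> F}"
  proof -
    have "{i\<in>A. \<phi> i \<in> F} = (\<Union>j\<in>F. {i\<in>A. \<phi> i = j})" by auto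
    then show ?thesis using assms by auto
  qed
  have "(\<Prod>j\<in>F. prod (\<lambda>i. g (\<phi> i)) {i \<in> {i\<in>A. \<phi> i \<in> F}. \<phi> i = j})
      = prod (\<lambda>i. g (\<phi> i)) {i\<in>A. \<phi> i \<in> F}"
    using fin assms(1) by (intro prod.group) auto
  moreover have "prod (\<lambda>i. g (\<phi> i)) {i \<in> {i\<in>A. \<phi> i \<in> F}. \<phi> i = j} = g j ^ card {i\<in>A. \<phi> i = j}"
    if "j \<in> F" for j
  proof -
    have "{i \<in> {i\<in>A. \<phi> i \<in> F}. \<phi> i = j} = {i\<in>A. \<phi> i = j}"
      using that by auto
    moreover have "prod (\<lambda>i. g (\<phi> i)) {i\<in>A. \<phi> i = j} = prod (\<lambda>_. g j) {i\<in>A. \<phi> i = j}"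
      by (intro prod.cong) auto
    ultimately show ?thesis
      by (simp only: prod_constant)
  qed
  ultimately show ?thesis
    by simp
qed

text \<open>Finite fibres make the preimage of a finite set of values finite, and these preimages
  are cofinal among the finite subsets of the index set. The grouped products therefore form a
  subnet of the original ones and share their limit; the zero factors are regrouped
  separately.\<close>

lemma has_prod_on_group_fibres:
  assumes prod: "has_prod_on (\<lambda>i. g (\<phi> i)) A p"
    and fin: "\<And>j. j \<in> B \<Longrightarrow> finite {i\<in>A. \<phi> i = j}" and image: "\<phi> ` A = B"
  shows "has_prod_on (\<lambda>j. g j ^ card {i\<in>A. \<phi> i = j}) B p"
proof -
  define G where "G = (\<lambda>j. g j ^ card {i\<in>A. \<phi> i = j})"
  \<comment> \<open>Surjectivity onto \<open>B\<close> excludes the exponent 0. Since 0 ^ 0 = 1, an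
    empty fibre could hide a zero of \<open>g\<close>; with positive exponents \<open>G\<close> and
    \<open>g\<close> have the same zeros.\<close>
  have card_pos: "card {i\<in>A. \<phi> i = j} > 0" if "j \<in> B" for j
    using that fin[OF that] image by (auto simp: card_gt_0_iff)
  have G0: "G j = 0 \<longleftrightarrow> g j = 0" if "j \<in> B" for j
    using card_pos[OF that] by (simp add: G_def)
  from prod obtain q where q: "q \<noteq> 0"
      "(prod (\<lambda>i. g (\<phi> i)) \<longlongrightarrow> q) (finite_subsets_at_top {i\<in>A. g (\<phi> i) \<noteq> 0})"
      "p = q * prod (\<lambda>i. g (\<phi> i)) {i\<in>A. g (\<phi> i) = 0}"
    and finZ: "finite {i\<in>A. g (\<phi> i) = 0}"
    unfolding has_prod_on_def by blast
  have "{j\<in>B. G j = 0} = \<phi> ` {i\<in>A. g (\<phi> i) = 0}"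
    using G0 image by auto
  then have finZ': "finite {j\<in>B. G j = 0}"
    using finZ by simp
  have "filterlim (\<lambda>F. {i\<in>A. \<phi> i \<in> F}) (finite_subsets_at_top {i\<in>A. g (\<phi> i) \<noteq> 0})
          (finite_subsets_at_top {j\<in>B. G j \<noteq> 0})"
    unfolding filterlim_finite_subsets_at_top
  proof (intro allI impI)
    fix X assume X: "finite X \<and> X \<subseteq> {i\<in>A. g (\<phi> i) \<noteq> 0}"
    show "\<forall>\<^sub>F F in finite_subsets_at_top {j\<in>B. G j \<noteq> 0}. finite {i\<in>A. \<phi> i \<in> F} \<and>
        X \<subseteq> {i\<in>A. \<phi> i \<in> F} \<and> {i\<in>A. \<phi> i \<in> F} \<subseteq> {i\<in>A. g (\<phi> i) \<noteq> 0}"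
      unfolding eventually_finite_subsets_at_top
    \<comment> \<open>Cofinality: once \<open>F\<close> contains the image of \<open>X\<close>, its
      preimage contains \<open>X\<close>.\<close>
    proof (rule exI[of _ "\<phi> ` X"], intro conjI allI impI)
      show "finite (\<phi> ` X)" using X by simp
      show "\<phi> ` X \<subseteq> {j\<in>B. G j \<noteq> 0}" using X G0 image by auto
      fix F assume F: "finite F \<and> \<phi> ` X \<subseteq> F \<and> F \<subseteq> {j\<in>B. G j \<noteq> 0}"
      have "{i\<in>A. \<phi> i \<in> F} = (\<Union>j\<in>F. {i\<in>A. \<phi> i = j})" by auto
      then show "finite {i\<in>A. \<phi> i \<in> F}" using F fin by auto
      show "X \<subseteq> {i\<in>A. \<phi> i \<in> F}" using X F by auto
      show "{i\<in>A. \<phi> i \<in> F} \<subseteq> {i\<in>A. g (\<phi> i) \<noteq> 0}" using F G0 by auto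
    qed
  qed
  from filterlim_compose[OF q(2) this]
  have "((\<lambda>F. prod (\<lambda>i. g (\<phi> i)) {i\<in>A. \<phi> i \<in> F}) \<longlongrightarrow> q) (finite_subsets_at_top {j\<in>B. G j \<noteq> 0})" .
  moreover have "eventually (\<lambda>F. prod (\<lambda>i. g (\<phi> i)) {i\<in>A. \<phi> i \<in> F} = prod G F)
      (finite_subsets_at_top {j\<in>B. G j \<noteq> 0})"
  proof (rule eventually_finite_subsets_at_top_weakI)
    fix F assume "finite F" "F \<subseteq> {j\<in>B. G j \<noteq> 0}"
    then show "prod (\<lambda>i. g (\<phi> i)) {i\<in>A. \<phi> i \<in> F} = prod G F"
      unfolding G_def by (intro prod_group_fibres fin) auto
  qed
  ultimately have lim: "(prod G \<longlongrightarrow> q) (finite_subsets_at_top {j\<in>B. G j \<noteq> 0})"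
    by (rule Lim_transform_eventually)
  define Z where "Z = {j\<in>B. G j = 0}"
  have "{i\<in>A. g (\<phi> i) = 0} = {i\<in>A. \<phi> i \<in> Z}"
    using G0 image by (auto simp: Z_def)
  moreover have "prod (\<lambda>i. g (\<phi> i)) {i\<in>A. \<phi> i \<in> Z} = prod G Z"
    unfolding G_def by (intro prod_group_fibres fin) (use finZ' in \<open>auto simp: Z_def\<close>)
  ultimately have "p = q * prod G {j\<in>B. G j = 0}"
    using q(3) by (simp add: Z_def)
  then have "has_prod_on G B p"
    unfolding has_prod_on_def using q(1) finZ' lim by blast
  then show ?thesis
    by (simp add: G_def)
qed

text \<open>Initial segments without the zero indices are cofinal among the finite sets of nonzero
  indices, so the unordered limit is also a sequential one. The two notions treat zeros differently:
  \<open>has_prod_on\<close> removes them individually, whereas \<open>has_prod\<close> starts after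
  a zero index.\<close>

lemma has_prod_on_imp_has_prod:
  fixes g :: "nat \<Rightarrow> complex"
  assumes "has_prod_on g UNIV p"
  shows "g has_prod p"
proof -
  define Z where "Z = {i. g i = 0}"
  from assms obtain q where q: "q \<noteq> 0" "(prod g \<longlongrightarrow> q) (finite_subsets_at_top (- Z))"
      "p = q * prod g Z" and finZ: "finite Z"
    unfolding has_prod_on_def by (auto simp: Z_def Compl_eq)
  have "filterlim (\<lambda>n. {..n} - Z) (finite_subsets_at_top (- Z)) sequentially"
    unfolding filterlim_finite_subsets_at_top
  proof (intro allI impI)
    fix X assume X: "finite X \<and> X \<subseteq> - Z"
    then obtain m where "X \<subseteq> {..m}"
      using finite_nat_iff_bounded_le by auto
    then have "finite ({..n} - Z) \<and> X \<subseteq> {..n} - Z \<and> {..n} - Z \<subseteq> - Z" if "n \<ge> m" for n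
      using X that by auto
    then show "\<forall>\<^sub>F n in sequentially. finite ({..n} - Z) \<and> X \<subseteq> {..n} - Z \<and> {..n} - Z \<subseteq> - Z"
      using eventually_sequentially by blast
  qed
  from filterlim_compose[OF q(2) this]
  have lim: "(\<lambda>n. prod g ({..n} - Z)) \<longlonglongrightarrow> q" .
  show ?thesis
  proof (cases "Z = {}")
    case True
    then show ?thesis
      using lim q by (simp add: has_prod_def raw_has_prod_def)
  next
    case False
    \<comment> \<open>Past the last zero no factor vanishes. The nonzero factors before it form a
      finite nonzero product \<open>a\<close>, and dividing by \<open>a\<close> leaves the tail with
      limit \<open>q / a\<close>.\<close>
    define i where "i = Max Z"
    have i: "i \<in> Z" and max: "\<And>j. j \<in> Z \<Longrightarrow> j \<le> i"
      using False finZ by (auto simp: i_def)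
    define a where "a = prod g ({..i} - Z)"
    have a: "a \<noteq> 0"
      by (auto simp: a_def Z_def)
    have "prod g ({..n + Suc i} - Z) = a * (\<Prod>k\<le>n. g (k + Suc i))" for n
    proof -
      have "{..n + Suc i} - Z = ({..i} - Z) \<union> {Suc i..n + Suc i}"
        using max by (force simp: not_le)
      then have "prod g ({..n + Suc i} - Z) = a * prod g {Suc i..n + Suc i}"
        unfolding a_def by (simp only:) (rule prod.union_disjoint; auto)
      also have "prod g {Suc i..n + Suc i} = (\<Prod>k\<le>n. g (k + Suc i))"
        using prod.shift_bounds_cl_nat_ivl[of g 0 "Suc i" n] by (simp add: atMost_atLeast0)
      finally show ?thesis .
    qed
    with LIMSEQ_ignore_initial_segment[OF lim, of "Suc i"]
    have "(\<lambda>n. a * (\<Prod>k\<le>n. g (k + Suc i))) \<longlonglongrightarrow> q"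
      by simp
    from tendsto_divide[OF this tendsto_const[of a]] a
    have "(\<lambda>n. \<Prod>k\<le>n. g (k + Suc i)) \<longlonglongrightarrow> q / a"
      by simp
    then have "raw_has_prod g (Suc i) (q / a)"
      using q a by (simp add: raw_has_prod_def)
    moreover have "g i = 0" and "p = 0"
      using i q(3) finZ by (auto simp: Z_def)
    ultimately show ?thesis
      by (auto simp: has_prod_def)
  qed
qed

section \<open>Tuples of positive integers\<close>

lemma sampling_tuples_sum_ge:
  assumes "n \<in> sampling_tuples S"
  shows "card S \<le> sum n S"
  using assms sum_mono[of S "\<lambda>_. 1" n] by (force simp: sampling_tuples_def PiE_iff)

lemma finite_sampling_tuples_sum_eq:
  assumes "finite S"
  shows "finite {n \<in> sampling_tuples S. sum n S = N}"
proof (rule finite_subset)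
  show "{n \<in> sampling_tuples S. sum n S = N} \<subseteq> (\<Pi>\<^sub>E k\<in>S. {..N})"
    using assms by (auto simp: sampling_tuples_def PiE_iff extensional_def intro: member_le_sum)
  show "finite (\<Pi>\<^sub>E k\<in>S. {..N})"
    using assms by (intro finite_PiE) auto
qed

text \<open>The hockey-stick identity, by Pascal's rule; it adds up the cases in the induction that
  counts compositions.\<close>

lemma sum_choose_shift: "(\<Sum>M\<in>{1..<N}. (M - 1) choose m) = (N - 1) choose Suc m"
proof (induction N)
  case (Suc N)
  then show ?case
    by (cases N) (simp_all add: atLeastLessThanSuc)
qed simp

text \<open>Induction on the index set: removing the entry at \<open>k\<close> leaves a tuple on
  \<open>S\<close> with some sum \<open>M\<close>, and the removed entry is forced to be
  \<open>N - M\<close>. Summing the smaller counts over \<open>M\<close> is the hockey-stick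
  identity.\<close>

lemma card_sampling_tuples_sum_eq:
  assumes "finite S" "S \<noteq> {}" "N \<ge> 1"
  shows "card {n \<in> sampling_tuples S. sum n S = N} = (N - 1) choose (card S - 1)"
  using assms
proof (induction S arbitrary: N rule: finite_ne_induct)
  case (singleton k)
  have "{n \<in> sampling_tuples {k}. sum n {k} = N} = {\<lambda>j\<in>{k}. N}"
    using singleton by (force simp: sampling_tuples_def PiE_iff extensional_def)
  then show ?case by simp
next
  case (insert k S)
  let ?T = "\<lambda>M. {n \<in> sampling_tuples S. sum n S = M}"
  let ?D = "SIGMA M:{1..<N}. ?T M"
  have "card {n \<in> sampling_tuples (insert k S). sum n (insert k S) = N} = card ?D"
  proof (rule bij_betw_same_card, rule bij_betw_byWitness)
    \<comment> \<open>The entry at \<open>k\<close> is reset to \<open>undefined\<close>, because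
      tuples in \<open>sampling_tuples S\<close> are extensional.\<close>
    let ?f = "\<lambda>n. (sum n S, n(k := undefined))" and ?h = "\<lambda>(M, n). n(k := N - M)"
    have sum_upd: "sum (n(k := x)) S = sum n S" for n :: "nat \<Rightarrow> nat" and x
      using insert by (intro sum.cong) auto
    \<comment> \<open>The range of \<open>M\<close> is 1 \<le> M < N: the lower end comes from
      \<open>S\<close> being nonempty, the upper end from the entry at \<open>k\<close> being at
      least 1.\<close>
    have pos: "sum n S \<ge> 1" if "n \<in> sampling_tuples S" for n
      using sampling_tuples_sum_ge[OF that] insert by (cases "card S") auto
    show "\<forall>n\<in>{n \<in> sampling_tuples (insert k S). sum n (insert k S) = N}. ?h (?f n) = n"
      using insert by (auto simp: fun_eq_iff)
    have "n(k := undefined) = n" if "n \<in> sampling_tuples S" for n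
      using that insert by (auto simp: sampling_tuples_def PiE_iff extensional_def)
    then show "\<forall>x\<in>?D. ?f (?h x) = x"
      by (auto simp: sum_upd simp del: fun_upd_apply)
    show "?f ` {n \<in> sampling_tuples (insert k S). sum n (insert k S) = N} \<subseteq> ?D"
    proof safe
      fix n assume n: "n \<in> sampling_tuples (insert k S)" "N = sum n (insert k S)"
      have restrict: "n(k := undefined) \<in> sampling_tuples S"
        using n insert unfolding sampling_tuples_def by (intro fun_upd_in_PiE)
      then show "n(k := undefined) \<in> sampling_tuples S" .
      show "sum (n(k := undefined)) S = sum n S" by (rule sum_upd)
      have "n k \<ge> 1" using n by (auto simp: sampling_tuples_def)
      then show "sum n S \<in> {1..<sum n (insert k S)}"
        using pos[OF restrict] insert by (simp add: sum_upd del: fun_upd_apply)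
    qed
    have "n(k := N - sum n S) \<in> sampling_tuples (insert k S)"
      if "n \<in> sampling_tuples S" "sum n S < N" for n
      using that by (auto simp: sampling_tuples_def PiE_iff extensional_def)
    moreover have "sum (n(k := N - sum n S)) (insert k S) = N" if "sum n S < N" for n
      using that insert(1,3) by (simp add: sum_upd fun_upd_same del: fun_upd_apply)
    ultimately show "?h ` ?D \<subseteq> {n \<in> sampling_tuples (insert k S). sum n (insert k S) = N}"
      by (auto simp del: fun_upd_apply)
  qed
  also have "\<dots> = (\<Sum>M\<in>{1..<N}. card (?T M))"
    using finite_sampling_tuples_sum_eq[OF insert(1)] by (intro card_SigmaI) auto
  also have "\<dots> = (\<Sum>M\<in>{1..<N}. (M - 1) choose (card S - 1))"
    using insert by (intro sum.cong) auto
  also have "\<dots> = (N - 1) choose card S"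
    using insert(1,2) by (subst sum_choose_shift) (simp add: card_gt_0_iff)
  finally show ?case
    using insert by simp
qed

text \<open>That every N \<ge> |S| is attained follows from the count: the binomial coefficient is
  positive there, so the fibre is nonempty.\<close>

lemma sum_sampling_tuples_image:
  assumes "finite S" "S \<noteq> {}"
  shows "(\<lambda>n. sum n S) ` sampling_tuples S = {card S..}"
proof safe
  fix N assume "N \<ge> card S"
  then have "card {n \<in> sampling_tuples S. sum n S = N} > 0"
    using assms by (subst card_sampling_tuples_sum_eq) (auto simp: Suc_le_eq card_gt_0_iff order.strict_trans2)
  then show "N \<in> (\<lambda>n. sum n S) ` sampling_tuples S"
    by (force simp: card_gt_0_iff)
qed (use sampling_tuples_sum_ge in auto)

text \<open>The power splits as a product of the \<open>x ^ n k\<close>, so the sum over tuples is a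
  product of |S| convergent geometric series. The product rule is stated for
  \<open>Infinite_Set_Sum\<close>, hence the translation in both directions.\<close>

lemma summable_on_sampling_tuples_power:
  fixes x :: real
  assumes "finite S" "0 \<le> x" "x < 1"
  shows "(\<lambda>n. x ^ sum n S) summable_on sampling_tuples S"
proof -
  have "(\<lambda>m. x ^ m) summable_on {1::nat..}"
    using has_sum_geometric_from_1[of x] assms by (auto simp: summable_on_def)
  then have "Infinite_Set_Sum.abs_summable_on (\<lambda>m. x ^ m) {1::nat..}"
    using assms by (simp add: abs_summable_equivalent[symmetric])
  then have "Infinite_Set_Sum.abs_summable_on (\<lambda>n. \<Prod>k\<in>S. x ^ n k) (sampling_tuples S)"
    unfolding sampling_tuples_def using assms by (intro abs_summable_on_prod_PiE) auto
  then show ?thesis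
    using assms by (simp add: abs_summable_equivalent[symmetric] power_sum abs_prod)
qed

section \<open>The geometric sampling product\<close>

text \<open>With a constant ratio the powers of \<open>r\<close> combine, so a factor sees its tuple
  only through the sum of the entries. The regrouping rests on this.\<close>

lemma sampling_factor_const:
  assumes "finite S"
  shows "sampling_factor (\<lambda>k. r) f S z n =
    f ((\<Prod>k\<in>S. sampling_root r k) * (z / r ^ sum n S))"
  using assms by (simp add: sampling_factor_def sampling_X_def prod_dividef power_sum)

lemma convergent_prod_on_sampling_factor_const:
  assumes "f field_differentiable at 0" "f 0 = 1" "norm r > 1" "finite S"
  shows "convergent_prod_on (sampling_factor (\<lambda>k. r) f S z) (sampling_tuples S)"
proof (rule convergent_prod_on_of_abs_summable)
  define w where "w = (\<lambda>N::nat. (\<Prod>k\<in>S. sampling_root r k) * (z / r ^ N))"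
  define x where "x = 1 / norm r"
  have x: "0 \<le> x" "x < 1"
    using assms by (auto simp: x_def divide_less_eq)
  have norm_w: "norm (w N) = norm (w 0) * x ^ N" for N
    by (simp add: w_def x_def norm_mult norm_divide norm_power power_divide)
  obtain D where "(f has_field_derivative D) (at 0)"
    using assms by (auto simp: field_differentiable_def)
  \<comment> \<open>The difference quotient at 0 is eventually below \<open>norm D + 1\<close>,
    where 1 is arbitrary slack. This makes \<open>f h - 1\<close> at most linear in
    \<open>h\<close>.\<close>
  then have "((\<lambda>h. norm ((f h - 1) / h)) \<longlongrightarrow> norm D) (at 0)"
    using assms by (intro tendsto_norm) (simp add: DERIV_def)
  then have "\<forall>\<^sub>F h in at 0. norm ((f h - 1) / h) < norm D + 1"
    by (rule order_tendstoD) simp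
  then have "\<forall>\<^sub>F h in at 0. norm (f h - 1) \<le> (norm D + 1) * norm h"
    using eventually_neq_at_within[of 0 0 UNIV]
  proof eventually_elim
    case (elim h)
    then have "norm (f h - 1) / norm h \<le> norm D + 1" and "norm h > 0"
      by (simp_all add: norm_divide)
    then show ?case
      by (simp add: pos_divide_le_eq)
  qed
  \<comment> \<open>The point 0 itself is included, since \<open>w N\<close> can be 0, for instance
    when z = 0; both sides vanish there.\<close>
  then have near0: "\<forall>\<^sub>F h in nhds 0. norm (f h - 1) \<le> (norm D + 1) * norm h"
    unfolding eventually_nhds_conv_at using assms(2) by simp
  have "(\<lambda>N. norm (w 0) * x ^ N) \<longlonglongrightarrow> 0"
    using x by (intro tendsto_mult_right_zero LIMSEQ_power_zero) auto
  then have "(\<lambda>N. norm (w N)) \<longlonglongrightarrow> 0"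
    by (simp only: norm_w[symmetric])
  then have "w \<longlonglongrightarrow> 0"
    by (rule tendsto_norm_zero_cancel)
  with near0 have "\<forall>\<^sub>F N in sequentially. norm (f (w N) - 1) \<le> (norm D + 1) * norm (w N)"
    by (rule eventually_compose_filterlim)
  then obtain N0 where N0: "\<And>N. N \<ge> N0 \<Longrightarrow> norm (f (w N) - 1) \<le> (norm D + 1) * norm (w N)"
    by (auto simp: eventually_sequentially)
  \<comment> \<open>From sum \<open>N0\<close> on, the linear bound gives comparison with the
    geometric tuple sum. Only finitely many tuples have a smaller sum, so the values of
    \<open>f\<close> at their arguments do not affect summability.\<close>
  let ?A = "{n \<in> sampling_tuples S. sum n S \<ge> N0}"
  let ?g = "sampling_factor (\<lambda>k. r) f S z"
  have "(\<lambda>n. ((norm D + 1) * norm (w 0)) * x ^ sum n S) summable_on ?A"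
    by (intro summable_on_cmult_right
        summable_on_subset_banach[OF summable_on_sampling_tuples_power[OF assms(4) x]]) auto
  then have "(\<lambda>n. norm (?g n - 1)) summable_on ?A"
  proof (rule summable_on_comparison_test)
    fix n assume "n \<in> ?A"
    then show "norm (?g n - 1) \<le> ((norm D + 1) * norm (w 0)) * x ^ sum n S"
      using N0[of "sum n S"] norm_w[of "sum n S"] assms
      by (simp add: sampling_factor_const w_def mult.assoc)
  qed auto
  moreover have "finite (sampling_tuples S - ?A)"
  proof -
    have "sampling_tuples S - ?A = (\<Union>N<N0. {n \<in> sampling_tuples S. sum n S = N})"
      by auto
    then show ?thesis
      using finite_sampling_tuples_sum_eq assms by auto
  qed
  then have "(\<lambda>n. norm (?g n - 1)) summable_on (sampling_tuples S - ?A)"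
    by (rule summable_on_finite)
  ultimately have "(\<lambda>n. norm (?g n - 1)) summable_on ?A \<union> (sampling_tuples S - ?A)"
    by (rule summable_on_union)
  moreover have "?A \<union> (sampling_tuples S - ?A) = sampling_tuples S"
    by auto
  ultimately show "(\<lambda>n. norm (?g n - 1)) summable_on sampling_tuples S"
    by simp
qed

theorem corollary1:
  fixes U :: "complex set" and c z r :: complex and R :: real
    and f :: "complex \<Rightarrow> complex" and S :: "nat set"
  assumes "U = ball c R" and "0 \<in> U" and "z \<in> U"
    and "f analytic_on U" and "\<And>w. w \<in> U \<Longrightarrow> f w \<noteq> 0" and "f 0 = 1"
    and "norm r > 1" and "\<And>k::nat. k \<ge> 1 \<Longrightarrow> Re (r ^ k) \<ge> 1 / 2"
    and "finite S" and "S \<noteq> {}" and "S \<subseteq> {1..}"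
  shows "convergent_prod_on (sampling_factor (\<lambda>k. r) f S z) (sampling_tuples S) \<and>
    convergent_prod (\<lambda>m. let n = m + card S in
      f ((\<Prod>k\<in>S. sampling_root r k) * (z / r ^ n)) ^ ((n - 1) choose (card S - 1))) \<and>
    geometric_sampling_product (\<lambda>k. r) f S z =
      (\<Prod>m. let n = m + card S in
        f ((\<Prod>k\<in>S. sampling_root r k) * (z / r ^ n)) ^ ((n - 1) choose (card S - 1)))"
proof -
  let ?A = "sampling_tuples S"
  define g where "g = (\<lambda>m. f ((\<Prod>k\<in>S. sampling_root r k) * (z / r ^ (m + card S))))"
  \<comment> \<open>The least sum of a tuple is |S|, so the shift makes index 0 correspond to n =
    |S|. On tuples the truncated subtraction is exact.\<close>
  define \<phi> where "\<phi> = (\<lambda>n. sum n S - card S)"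
  have "f field_differentiable at 0"
    using assms by (auto intro: analytic_on_imp_differentiable_at)
  then have conv: "convergent_prod_on (sampling_factor (\<lambda>k. r) f S z) ?A"
    using assms by (intro convergent_prod_on_sampling_factor_const)
  then obtain p where p: "has_prod_on (sampling_factor (\<lambda>k. r) f S z) ?A p"
    by (auto simp: convergent_prod_on_def)
  have fibre: "{n\<in>?A. \<phi> n = m} = {n\<in>?A. sum n S = m + card S}" for m
    using sampling_tuples_sum_ge[of _ S] by (force simp: \<phi>_def)
  have card_fibre: "card {n\<in>?A. \<phi> n = m} = (m + card S - 1) choose (card S - 1)" for m
    unfolding fibre using assms
    by (intro card_sampling_tuples_sum_eq) (auto simp: Suc_le_eq card_gt_0_iff)
  have "sampling_factor (\<lambda>k. r) f S z n = g (\<phi> n)" if "n \<in> ?A" for n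
    using sampling_tuples_sum_ge[OF that] assms by (simp add: sampling_factor_const g_def \<phi>_def)
  then have "has_prod_on (\<lambda>n. g (\<phi> n)) ?A p"
    using p by (rule has_prod_on_cong[THEN iffD1])
  moreover have "\<phi> ` ?A = UNIV"
  proof -
    have "\<phi> ` ?A = (\<lambda>N. N - card S) ` (\<lambda>n. sum n S) ` ?A"
      by (auto simp: \<phi>_def image_image)
    \<comment> \<open>The index m comes from the sum m + |S|, which some tuple attains.\<close>
    also have "\<dots> = UNIV"
      using assms by (force simp: sum_sampling_tuples_image intro: image_eqI[where x = "_ + card S"])
    finally show ?thesis .
  qed
  moreover have "finite {n\<in>?A. \<phi> n = m}" for m
    unfolding fibre using assms by (intro finite_sampling_tuples_sum_eq)
  ultimately have "has_prod_on (\<lambda>m. g m ^ card {n\<in>?A. \<phi> n = m}) UNIV p"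
    by (intro has_prod_on_group_fibres)
  then have prod: "(\<lambda>m. g m ^ ((m + card S - 1) choose (card S - 1))) has_prod p"
    unfolding card_fibre by (rule has_prod_on_imp_has_prod)
  then have "convergent_prod (\<lambda>m. g m ^ ((m + card S - 1) choose (card S - 1)))"
    unfolding has_prod_def convergent_prod_def by blast
  moreover have "geometric_sampling_product (\<lambda>k. r) f S z =
      (\<Prod>m. g m ^ ((m + card S - 1) choose (card S - 1)))"
    unfolding geometric_sampling_product_def prod_on_eqI[OF p] by (rule has_prod_unique[OF prod])
  ultimately show ?thesis
    using conv by (simp add: g_def Let_def)
qed

end
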